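(* Let $(T,d)$ be a metric space, $m$ a Borel probability measure on $T$ with $\operatorname{supp}(m)=T$, and $\varphi:\mathbb{R}_+\to\mathbb{R}$ a Young function. Suppose that $m$ is a majorizing measure, i.e. $\mathcal{S}:=\sup_{x\in T}\int_0^{D(T)}\varphi^{-1}\left(\frac{1}{m(B(x,\varepsilon))}\right)d\varepsilon<\infty$. Then for each separable real-valued stochastic process $X(t)$, $t\in T$, such that $$\sup_{s,t\in T}\mathbf{E}\,\varphi\left(\frac{|X(s)-X(t)|}{d(s,t)}\right)\le 1,$$ the following inequality holds: $$\mathbf{E}\sup_{s,t\in T}|X(s)-X(t)|\le 32\,\mathcal{S}.$$
   Context: $B(x,\varepsilon)=\{y\in T: d(x,y)\le\varepsilon\}$ is the closed ball; $D(T)=\sup\{d(s,t):s,t\in T\}$ is the diameter of $T$. A Young function is a (strictly) increasing convex function $\varphi:\mathbb{R}_+\to\mathbb{R}$ with $\varphi(0)=0$; $\varphi^{-1}$ is its inverse. The convention $0/0=0$ is used (so the terms with $s=t$ contribute $\varphi(0)=0$). For a separable process, expectations of suprema over $T$ are understood as suprema over finite subsets: $\mathbf{E}\sup_{s,t\in T}|X(s)-X(t)|:=\sup_{F\subset T,\ F\text{ finite}}\mathbf{E}\sup_{s,t\in F}|X(s)-X(t)|$. *)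

theory Defs
  imports "HOL-Probability.Probability"
begin

definition young_function :: "(real \<Rightarrow> real) \<Rightarrow> bool" where
  "young_function \<phi> \<longleftrightarrow> strict_mono_on {0..} \<phi> \<and> convex_on {0..} \<phi> \<and> \<phi> 0 = 0"

text \<open>A Young function maps \<open>{0..}\<close> bijectively onto \<open>{0..}\<close>; only its values on \<open>{0..}\<close> matter.\<close>

definition young_inv :: "(real \<Rightarrow> real) \<Rightarrow> real \<Rightarrow> real" where
  "young_inv \<phi> = the_inv_into {0..} \<phi>"

text \<open>The metric space is the whole type. The diameter is extended-real valued because the
  library's real-valued \<open>diameter\<close> is not meaningful for unbounded sets.\<close>

definition ediam :: "'a::metric_space itself \<Rightarrow> ennreal" where
  "ediam _ = (SUP (s, t) \<in> (UNIV :: ('a \<times> 'a) set). ennreal (dist s t))"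

definition msupport :: "'a::topological_space measure \<Rightarrow> 'a set" where
  "msupport m = {x. \<forall>U. open U \<and> x \<in> U \<longrightarrow> emeasure m U > 0}"

text \<open>When \<open>msupport m = UNIV\<close>, the balls below have positive measure, so \<open>1 / measure m _\<close> is a
  genuine quotient.\<close>

definition majorizing_sup :: "(real \<Rightarrow> real) \<Rightarrow> 'a::metric_space measure \<Rightarrow> ennreal" where
  "majorizing_sup \<phi> m =
     (SUP x. \<integral>\<^sup>+\<epsilon>\<in>{\<epsilon>. 0 < \<epsilon> \<and> ennreal \<epsilon> \<le> ediam TYPE('a)}.
        ennreal (young_inv \<phi> (1 / measure m (cball x \<epsilon>))) \<partial>lborel)"

text \<open>Separability in the sense of Doob, relative to the class of closed subsets of the line.\<close>

definition separable_process ::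
    "'w measure \<Rightarrow> ('a::metric_space \<Rightarrow> 'w \<Rightarrow> real) \<Rightarrow> bool" where
  "separable_process P X \<longleftrightarrow>
     (\<forall>t. X t \<in> borel_measurable P) \<and>
     (\<exists>D N. countable D \<and> N \<in> null_sets P \<and>
        (\<forall>\<omega> \<in> space P - N. \<forall>G A. open G \<and> closed A \<and> (\<forall>s \<in> D \<inter> G. X s \<omega> \<in> A)
            \<longrightarrow> (\<forall>t \<in> G. X t \<omega> \<in> A)))"

text \<open>The expected supremum over the whole index set is by convention the supremum over its
  finite subsets; the inner supremum over the empty set is \<open>0\<close>.\<close>

definition expected_sup_incr ::
    "'w measure \<Rightarrow> ('a \<Rightarrow> 'w \<Rightarrow> real) \<Rightarrow> ennreal" where
  "expected_sup_incr P X =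
     (SUP F \<in> {F. finite F}. \<integral>\<^sup>+\<omega>. (SUP (s, t) \<in> F \<times> F. ennreal \<bar>X s \<omega> - X t \<omega>\<bar>) \<partial>P)"

end

theory Submission
  imports Defs
begin

text \<open>Put \<open>c k = \<phi>\<inverse>(1) 4\<^sup>k\<close> and let \<open>rad k x\<close> be the least radius \<open>r\<close> with
  \<open>\<phi>\<inverse>(1 / m(B(x, r))) \<le> c k\<close>. Comparing layers of the integral defining \<open>S\<close> gives
  \<open>\<Sum>\<^sub>k c k * rad k x \<le> 4/3 S\<close>. For a fixed path \<open>f\<close>, the mean deviation
  \<open>N(u) = \<integral> |f(u) - f(w)| m(dw)\<close> satisfies \<open>N(u) \<le> |f(u) - f(v)| + N(v)\<close>, so its average over
  \<open>B(x, rad n x)\<close> can be compared with its average over the balls of scale \<open>n - 1\<close>, and so on down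
  to scale \<open>0\<close>, where the ball has full measure. Convexity in the form
  \<open>a \<le> y + y \<phi>(a) / \<phi>(y)\<close>, applied to \<open>a = |f(u) - f(v)| / d(u, v)\<close> and \<open>y = c n\<close>, splits the error of each
  step into a multiple of the radii, contributing \<open>8 S\<close> in total, and an integral of
  \<open>\<phi>(|f(u) - f(v)| / d(u, v))\<close> that does not depend on \<open>x\<close> and contributes \<open>16/3 S\<close> in expectation.
  With \<open>8/3 S\<close> for scale \<open>0\<close> this makes \<open>16 S\<close> for each of the two points of an increment.

  Averaging a path over the index space needs joint measurability; \<open>T\<close> is totally bounded and the
  process is continuous in mean, so there is a jointly measurable modification, which has the same
  suprema over finite sets almost surely.\<close>

section \<open>Young functions\<close>

lemma young_function_nonneg:
  assumes "young_function \<phi>" "0 \<le> x"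
  shows "0 \<le> \<phi> x"
  using assms strict_mono_onD[of "{0..}" \<phi> 0 x]
  by (cases "x = 0") (auto simp: young_function_def)

lemma young_function_pos:
  assumes "young_function \<phi>" "0 < x"
  shows "0 < \<phi> x"
  using assms strict_mono_onD[of "{0..}" \<phi> 0 x] by (auto simp: young_function_def)

lemma young_function_mono:
  assumes "young_function \<phi>" "0 \<le> x" "x \<le> y"
  shows "\<phi> x \<le> \<phi> y"
  using assms strict_mono_onD[of "{0..}" \<phi> x y]
  by (cases "x = y") (auto simp: young_function_def)

text \<open>Convexity on the segment from 0 to y, where x is the point of weight x / y: the slope
  \<phi>(t) / t is nondecreasing. The product form also covers 0.\<close>

lemma young_function_scale:
  assumes "young_function \<phi>" "0 \<le> x" "x \<le> y"
  shows "y * \<phi> x \<le> x * \<phi> y"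
proof (cases "y = 0")
  case True
  then show ?thesis using assms by simp
next
  case False
  then have y: "0 < y" using assms by simp
  have "\<phi> ((1 - x / y) *\<^sub>R 0 + (x / y) *\<^sub>R y) \<le> (1 - x / y) * \<phi> 0 + (x / y) * \<phi> y"
    by (rule convex_onD[of "{0..}"]) (use assms y in \<open>auto simp: young_function_def\<close>)
  then show ?thesis using assms y by (simp add: young_function_def field_simps)
qed

text \<open>Slope comparison brackets a positive y between two values of \<phi>. Convexity gives
  continuity on the open half-line, so the intermediate value theorem is applied away from
  0.\<close>

lemma young_function_surj:
  assumes "young_function \<phi>" "0 \<le> y"
  shows "\<exists>x\<ge>0. \<phi> x = y"
proof (cases "y = 0")
  case True
  then show ?thesis using assms by (auto simp: young_function_def)
next
  case False
  then have y: "0 < y" using assms by simp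
  have p: "0 < \<phi> 1" using young_function_pos[OF assms(1)] by simp
  \<comment> \<open>The line t \<phi>(1) lies above \<phi> on [0, 1] and below it from 1 on, so
    \<phi>(a) \<le> y \<le> \<phi>(b).\<close>
  define a where "a = min 1 (y / \<phi> 1)"
  define b where "b = max 1 (y / \<phi> 1)"
  have a: "0 < a" "a \<le> 1" and b: "1 \<le> b" using y p by (auto simp: a_def b_def)
  have "\<phi> a \<le> a * \<phi> 1" using young_function_scale[OF assms(1), of a 1] a by simp
  also have "\<dots> \<le> y" using p by (simp add: a_def min_def field_simps)
  finally have lo: "\<phi> a \<le> y" .
  have "y \<le> b * \<phi> 1" using p by (simp add: b_def max_def field_simps)
  also have "\<dots> \<le> \<phi> b" using young_function_scale[OF assms(1), of 1 b] b by simp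
  finally have hi: "y \<le> \<phi> b" .
  have "convex_on {0<..} \<phi>"
    by (rule convex_on_subset[of "{0..}"]) (use assms in \<open>auto simp: young_function_def\<close>)
  then have "continuous_on {0<..} \<phi>" by (intro convex_on_continuous) auto
  then have "continuous_on {a..b} \<phi>" by (rule continuous_on_subset) (use a in auto)
  then obtain x where "a \<le> x" "x \<le> b" "\<phi> x = y"
    using IVT'[of \<phi> a y b] lo hi a b by auto
  then show ?thesis using a by (intro exI[of _ x]) auto
qed

lemma young_inv_works:
  assumes "young_function \<phi>" "0 \<le> y"
  shows "0 \<le> young_inv \<phi> y" "\<phi> (young_inv \<phi> y) = y"
proof -
  have inj: "inj_on \<phi> {0..}"
    using assms(1) by (auto simp: young_function_def intro: strict_mono_on_imp_inj_on)
  obtain x where x: "0 \<le> x" "\<phi> x = y" using young_function_surj[OF assms] by auto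
  then have "young_inv \<phi> y = x"
    unfolding young_inv_def using the_inv_into_f_f[OF inj, of x] by auto
  then show "0 \<le> young_inv \<phi> y" "\<phi> (young_inv \<phi> y) = y" using x by auto
qed

text \<open>Strict monotonicity read contrapositively; lower bounds for the integrand of
  \<open>majorizing_sup\<close> come from here.\<close>

lemma young_inv_ge:
  assumes "young_function \<phi>" "0 \<le> c" "\<phi> c \<le> y"
  shows "c \<le> young_inv \<phi> y"
proof (rule ccontr)
  assume *: "\<not> c \<le> young_inv \<phi> y"
  have y: "0 \<le> y" using young_function_nonneg[OF assms(1,2)] assms(3) by simp
  have "\<phi> (young_inv \<phi> y) < \<phi> c"
    using * assms young_inv_works(1)[OF assms(1) y]
    by (intro strict_mono_onD[of "{0..}" \<phi>]) (auto simp: young_function_def)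
  then show False using young_inv_works(2)[OF assms(1) y] assms(3) by simp
qed

text \<open>Either a \<le> y, or the monotone slope gives a \<le> y \<phi>(a) / \<phi>(y). This
  takes the place of Young's inequality with a conjugate function and leaves the threshold
  \<open>y\<close> free.\<close>

lemma young_ineq:
  assumes "young_function \<phi>" "0 \<le> a" "0 < y"
  shows "a \<le> y + y / \<phi> y * \<phi> a"
proof (cases "a \<le> y")
  case True
  then show ?thesis
    using young_function_nonneg[OF assms(1,2)] young_function_pos[OF assms(1,3)] assms(3)
    by (simp add: add_increasing2)
next
  case False
  then have "a * \<phi> y \<le> y * \<phi> a" using young_function_scale[OF assms(1), of y a] assms by simp
  then have "a \<le> y / \<phi> y * \<phi> a" using young_function_pos[OF assms(1,3)] by (simp add: field_simps)
  then show ?thesis using assms(3) by simp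
qed

text \<open>\<open>young_ineq\<close> at the difference quotient, multiplied by the distance; for u
  = v the left side is 0.\<close>

lemma young_ineq_increment:
  fixes f :: "'a::metric_space \<Rightarrow> real"
  assumes "young_function \<phi>" "0 < y"
  shows "ennreal \<bar>f u - f v\<bar> \<le> ennreal (dist u v * y)
    + ennreal (dist u v * y / \<phi> y) * ennreal (\<phi> (\<bar>f u - f v\<bar> / dist u v))"
proof (cases "u = v")
  case False
  let ?a = "\<bar>f u - f v\<bar> / dist u v"
  have d: "0 < dist u v" using False by simp
  have p: "0 < \<phi> y" by (rule young_function_pos[OF assms])
  have q: "0 \<le> \<phi> ?a" by (rule young_function_nonneg[OF assms(1)]) simp
  have "\<bar>f u - f v\<bar> = dist u v * ?a" using d by simp
  also have "\<dots> \<le> dist u v * (y + y / \<phi> y * \<phi> ?a)"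
    using d by (intro mult_left_mono young_ineq[OF assms(1) _ assms(2)]) auto
  finally have "ennreal \<bar>f u - f v\<bar> \<le> ennreal (dist u v * y + dist u v * y / \<phi> y * \<phi> ?a)"
    by (simp add: algebra_simps)
  also have "\<dots> = ennreal (dist u v * y) + ennreal (dist u v * y / \<phi> y * \<phi> ?a)"
    by (rule ennreal_plus) (use d p q assms(2) in auto)
  also have "ennreal (dist u v * y / \<phi> y * \<phi> ?a)
      = ennreal (dist u v * y / \<phi> y) * ennreal (\<phi> ?a)"
    by (rule ennreal_mult) (use d p q assms(2) in auto)
  finally show ?thesis .
qed simp

text \<open>\<phi> is arbitrary on negative numbers, so it is composed with \<open>max 0\<close>,
  which makes it monotone on the whole line and hence Borel.\<close>

lemma young_function_measurable:
  assumes "young_function \<phi>" "g \<in> borel_measurable M" "\<And>x. 0 \<le> g x"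
  shows "(\<lambda>x. \<phi> (g x)) \<in> borel_measurable M"
proof -
  have "mono (\<lambda>x. \<phi> (max 0 x))"
    by (intro monoI young_function_mono[OF assms(1)]) auto
  then have "(\<lambda>x. \<phi> (max 0 x)) \<in> borel_measurable borel" by (rule borel_measurable_mono)
  from measurable_compose[OF assms(2) this] show ?thesis by (simp add: assms(3) max_absorb2)
qed

section \<open>The radii attached to a majorizing measure\<close>

locale majorizing_measure = prob_space m
  for m :: "'a::metric_space measure" +
  fixes \<phi> :: "real \<Rightarrow> real"
  assumes sets_borel: "sets m = sets borel"
    and support: "msupport m = UNIV"
    and young: "young_function \<phi>"
    and majorizing: "majorizing_sup \<phi> m < \<infinity>"
begin

lemma space_UNIV: "space m = UNIV"
  using sets_eq_imp_space_eq[OF sets_borel] by simp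

lemma cball_sets [measurable, simp]: "cball x e \<in> sets m"
  by (simp add: sets_borel)

lemma measure_cball_pos:
  assumes "0 < e"
  shows "0 < measure m (cball x e)"
proof -
  have "0 < emeasure m (ball x e)"
  proof -
    have "x \<in> msupport m" by (simp add: support)
    then show ?thesis using assms by (simp add: msupport_def)
  qed
  also have "\<dots> \<le> emeasure m (cball x e)" by (intro emeasure_mono) auto
  finally show ?thesis by (simp add: emeasure_eq_measure)
qed

definition S :: real where "S = enn2real (majorizing_sup \<phi> m)"

lemma majorizing_sup_eq: "majorizing_sup \<phi> m = ennreal S" and S_nonneg: "0 \<le> S"
  using majorizing by (auto simp: S_def)

text \<open>The starting level \<phi>\<inverse>(1) is the value of the integrand at a ball of full
  mass, its least possible value.\<close>

definition c :: "nat \<Rightarrow> real" where "c k = young_inv \<phi> 1 * 4 ^ k"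

lemma phi_c0: "\<phi> (c 0) = 1"
  using young_inv_works[OF young, of 1] by (simp add: c_def)

lemma c_pos: "0 < c k"
proof -
  have "young_inv \<phi> 1 \<noteq> 0"
    using young_inv_works(2)[OF young, of 1] young by (auto simp: young_function_def)
  then show ?thesis using young_inv_works(1)[OF young, of 1] by (auto simp: c_def)
qed

lemma c_Suc: "c (Suc k) = 4 * c k"
  by (simp add: c_def)

lemma c0_le: "c 0 \<le> c k"
  by (induction k) (use c_pos in \<open>auto simp: c_Suc intro: order_trans\<close>)

text \<open>Telescoping of 3 c(k) = c(k + 1) - c(k). The ratio 4 enters the constants through this
  identity.\<close>

lemma sum_c: "3 * (\<Sum>k<n. c k) = c n - c 0"
  by (induction n) (auto simp: c_Suc algebra_simps)

lemma phi_c_ge_1: "1 \<le> \<phi> (c k)"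
  using young_function_mono[OF young _ c0_le[of k]] c_pos[of 0] phi_c0 by simp

lemma integrand_ge:
  assumes "0 < e"
  shows "c 0 \<le> young_inv \<phi> (1 / measure m (cball x e))"
  by (rule young_inv_ge[OF young])
     (use c_pos[of 0] measure_cball_pos[OF assms, of x] phi_c0 in \<open>auto simp: field_simps\<close>)

text \<open>The integrand is at least \<open>c 0\<close> > 0, so an unbounded space would make the
  integral infinite.\<close>

lemma ediam_finite: "ediam TYPE('a) < \<infinity>"
proof (rule ccontr)
  assume "\<not> ediam TYPE('a) < \<infinity>"
  then have top: "ediam TYPE('a) = \<infinity>" by (simp add: less_top[symmetric])
  fix x :: 'a
  have "ennreal (c 0) * emeasure lborel {0::real<..} =
      (\<integral>\<^sup>+e. ennreal (c 0) * indicator {0<..} e \<partial>(lborel::real measure))"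
    by (subst nn_integral_cmult_indicator) auto
  also have "\<dots> \<le> (\<integral>\<^sup>+\<epsilon>\<in>{\<epsilon>. 0 < \<epsilon> \<and> ennreal \<epsilon> \<le> ediam TYPE('a)}.
        ennreal (young_inv \<phi> (1 / measure m (cball x \<epsilon>))) \<partial>lborel)"
    by (intro nn_integral_mono) (auto simp: top indicator_def integrand_ge ennreal_leI)
  also have "\<dots> \<le> majorizing_sup \<phi> m"
    unfolding majorizing_sup_def by (rule SUP_upper) simp
  also have "\<dots> < \<infinity>" by (rule majorizing)
  moreover have "emeasure lborel {0::real<..} = \<infinity>"
  proof (rule ccontr)
    assume "emeasure lborel {0::real<..} \<noteq> \<infinity>"
    then obtain a where a: "0 \<le> a" "emeasure lborel {0::real<..} = ennreal a"
      by (cases "emeasure lborel {0::real<..}") auto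
    have "ennreal (a + 1) = emeasure lborel {0<..a + 1}" using a by simp
    also have "\<dots> \<le> ennreal a" unfolding a(2)[symmetric] by (intro emeasure_mono) auto
    finally show False using a by simp
  qed
  ultimately show False using c_pos[of 0] by (simp add: ennreal_mult_top)
qed

definition diam :: real where "diam = enn2real (ediam TYPE('a))"

lemma ediam_eq: "ediam TYPE('a) = ennreal diam" and diam_nonneg: "0 \<le> diam"
  using ediam_finite by (auto simp: diam_def)

lemma dist_le_diam: "dist (x::'a) y \<le> diam"
proof -
  have "ennreal (dist x y) \<le> ediam TYPE('a)"
    unfolding ediam_def by (rule SUP_upper2[of "(x, y)"]) auto
  then show ?thesis by (simp add: ediam_eq diam_nonneg)
qed

text \<open>The condition says that the ball has mass at least 1 / \<phi>(c k). The product form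
  also makes sense at radius 0, where the ball may be a null set.\<close>

definition rad :: "nat \<Rightarrow> 'a \<Rightarrow> real" where
  "rad k x = Inf {e. 0 \<le> e \<and> 1 \<le> \<phi> (c k) * measure m (cball x e)}"

lemma rad_le:
  assumes "0 \<le> e" "1 \<le> \<phi> (c k) * measure m (cball x e)"
  shows "rad k x \<le> e"
  unfolding rad_def using assms by (intro cInf_lower bdd_belowI[of _ 0]) auto

lemma rad_set_diam: "1 \<le> \<phi> (c k) * measure m (cball x diam)"
proof -
  have "cball x diam = space m" using dist_le_diam by (auto simp: space_UNIV)
  then show ?thesis using phi_c_ge_1[of k] by (simp add: prob_space)
qed

lemma rad_nonneg: "0 \<le> rad k x"
  unfolding rad_def by (rule cInf_greatest) (use rad_set_diam diam_nonneg in auto)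

lemma rad_le_diam: "rad k x \<le> diam"
  by (rule rad_le[OF diam_nonneg rad_set_diam])

text \<open>The infimum is attained: the closed balls of radii decreasing to \<open>rad k x\<close>
  intersect in the ball of that radius, and m is continuous from above.\<close>

lemma measure_cball_rad: "1 \<le> \<phi> (c k) * measure m (cball x (rad k x))"
proof -
  let ?A = "\<lambda>n. cball x (rad k x + 1 / Suc n)"
  have "(\<lambda>n. measure m (?A n)) \<longlonglongrightarrow> measure m (\<Inter>n. ?A n)"
  proof (rule finite_Lim_measure_decseq)
    show "decseq ?A"
      by (intro decseq_SucI subset_cball) (auto intro!: frac_le)
  qed auto
  moreover have "(\<Inter>n. ?A n) = cball x (rad k x)"
  proof (intro equalityI subsetI)
    fix y assume y: "y \<in> (\<Inter>n. ?A n)"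
    have "dist x y \<le> rad k x"
    proof (rule LIMSEQ_le_const)
      show "(\<lambda>n. rad k x + 1 / Suc n) \<longlonglongrightarrow> rad k x"
        using tendsto_add[OF tendsto_const LIMSEQ_inverse_real_of_nat, of "rad k x"]
        by (simp add: inverse_eq_divide)
    qed (use y in auto)
    then show "y \<in> cball x (rad k x)" by simp
  qed (auto intro: order_trans)
  ultimately have lim: "(\<lambda>n. \<phi> (c k) * measure m (?A n)) \<longlonglongrightarrow> \<phi> (c k) * measure m (cball x (rad k x))"
    by (intro tendsto_intros) simp
  have "1 \<le> \<phi> (c k) * measure m (?A n)" for n
  proof -
    have "rad k x < rad k x + 1 / Suc n" by simp
    then obtain e where e: "0 \<le> e" "1 \<le> \<phi> (c k) * measure m (cball x e)" "e < rad k x + 1 / Suc n"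
      unfolding rad_def using cInf_lessD rad_set_diam diam_nonneg by (smt (verit) empty_iff mem_Collect_eq)
    have "\<phi> (c k) * measure m (cball x e) \<le> \<phi> (c k) * measure m (?A n)"
      using e phi_c_ge_1[of k] by (intro mult_left_mono finite_measure_mono subset_cball) auto
    then show ?thesis using e by simp
  qed
  then show ?thesis by (intro LIMSEQ_le_const[OF lim]) auto
qed

text \<open>The enlarged ball around \<open>y\<close> contains the ball around \<open>x\<close>,
  which already has the required mass.\<close>

lemma rad_lipschitz: "rad k y \<le> rad k x + dist x y"
proof (rule rad_le)
  have "cball x (rad k x) \<subseteq> cball y (rad k x + dist x y)"
    by (auto simp: dist_commute) (smt (verit) dist_commute dist_triangle)
  then have "\<phi> (c k) * measure m (cball x (rad k x)) \<le> \<phi> (c k) * measure m (cball y (rad k x + dist x y))"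
    using phi_c_ge_1[of k] by (intro mult_left_mono finite_measure_mono) auto
  then show "1 \<le> \<phi> (c k) * measure m (cball y (rad k x + dist x y))"
    using measure_cball_rad[of k x] by simp
qed (use rad_nonneg in auto)

lemma rad_measurable [measurable]: "rad k \<in> borel_measurable m"
proof -
  have "continuous_on UNIV (rad k)"
  proof (rule continuous_onI)
    fix x and e :: real assume "0 < e"
    moreover have "dist (rad k x') (rad k x) \<le> dist x' x" for x'
      using rad_lipschitz[of k x x'] rad_lipschitz[of k x' x]
      by (simp add: dist_real_def dist_commute abs_le_iff)
    ultimately show "\<exists>d>0. \<forall>x'\<in>UNIV. dist x' x < d \<longrightarrow> dist (rad k x') (rad k x) \<le> e"
      by (meson less_imp_le order_trans)
  qed
  then have "rad k \<in> borel_measurable borel" by (rule borel_measurable_continuous_onI)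
  then show ?thesis using measurable_cong_sets[OF sets_borel refl] by blast
qed

section \<open>The weighted sum of the radii\<close>

lemma integrand_ge_of_less_rad:
  assumes "0 < e" "e < rad k x"
  shows "c k \<le> young_inv \<phi> (1 / measure m (cball x e))"
proof (rule young_inv_ge[OF young])
  have "\<phi> (c k) * measure m (cball x e) < 1"
    using rad_le[of e k x] assms by force
  then show "\<phi> (c k) \<le> 1 / measure m (cball x e)"
    using measure_cball_pos[OF assms(1), of x] by (simp add: field_simps)
qed (use c_pos[of k] in simp)

text \<open>Only levels whose radius exceeds \<open>e\<close> contribute. The induction picks out
  the largest of them: the geometric sum up to it is at most 4/3 of its last term, and the integrand
  is at least that term.\<close>

lemma sum_c_below_rad:
  assumes "0 < e"
  shows "(\<Sum>k\<le>n. c k * indicator {0<..<rad k x} e)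
    \<le> 4 / 3 * young_inv \<phi> (1 / measure m (cball x e))"
proof (induction n)
  case 0
  show ?case
    using integrand_ge[OF assms, of x] c_pos[of 0] by (cases "e < rad 0 x") (simp_all add: assms)
next
  case (Suc n)
  show ?case
  proof (cases "e < rad (Suc n) x")
    case True
    have "(\<Sum>k\<le>Suc n. c k * indicator {0<..<rad k x} e) \<le> (\<Sum>k\<le>Suc n. c k)"
      by (intro sum_mono) (use c_pos less_imp_le in \<open>auto simp: indicator_def\<close>)
    \<comment> \<open>By \<open>sum_c\<close> the full sum is (c(n + 2) - c(0)) / 3, and c(n + 2) =
      4 c(n + 1).\<close>
    also have "\<dots> \<le> 4 / 3 * c (Suc n)"
      using sum_c[of "Suc (Suc n)"] c_pos[of 0]
      by (simp add: lessThan_Suc_atMost c_Suc[of "Suc n"] del: sum.atMost_Suc)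
    also have "\<dots> \<le> 4 / 3 * young_inv \<phi> (1 / measure m (cball x e))"
      using integrand_ge_of_less_rad[OF assms True] by simp
    finally show ?thesis .
  next
    case False
    then show ?thesis using Suc by simp
  qed
qed

text \<open>Each radius is the length of the interval (0, rad k x), so the sum is an integral over
  \<open>e\<close> of the quantity bounded in \<open>sum_c_below_rad\<close>.\<close>

lemma sum_c_rad: "(\<Sum>k\<le>n. c k * rad k x) \<le> 4 / 3 * S"
proof -
  have eq: "ennreal (\<Sum>k\<le>n. c k * rad k x)
      = (\<integral>\<^sup>+e. (\<Sum>k\<le>n. ennreal (c k * indicator {0<..<rad k x} e)) \<partial>lborel)"
  proof -
    have "ennreal (\<Sum>k\<le>n. c k * rad k x) = (\<Sum>k\<le>n. ennreal (c k) * emeasure lborel {0<..<rad k x})"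
      using c_pos rad_nonneg by (subst sum_ennreal[symmetric]) (auto simp: ennreal_mult less_imp_le)
    also have "\<dots> = (\<Sum>k\<le>n. \<integral>\<^sup>+e. ennreal (c k) * indicator {0<..<rad k x} e \<partial>lborel)"
      by (subst nn_integral_cmult_indicator) auto
    also have "\<dots> = (\<Sum>k\<le>n. \<integral>\<^sup>+e. ennreal (c k * indicator {0<..<rad k x} e) \<partial>lborel)"
      by (intro sum.cong nn_integral_cong) (auto simp: indicator_def)
    also have "\<dots> = (\<integral>\<^sup>+e. (\<Sum>k\<le>n. ennreal (c k * indicator {0<..<rad k x} e)) \<partial>lborel)"
      by (subst nn_integral_sum) auto
    finally show ?thesis .
  qed
  have "ennreal (3 / 4 * (\<Sum>k\<le>n. c k * rad k x))
      = (\<integral>\<^sup>+e. ennreal (3 / 4) * (\<Sum>k\<le>n. ennreal (c k * indicator {0<..<rad k x} e)) \<partial>lborel)"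
    by (subst nn_integral_cmult) (simp_all only: eq[symmetric], auto simp: ennreal_mult'[symmetric])
  also have "\<dots> \<le> (\<integral>\<^sup>+\<epsilon>\<in>{\<epsilon>. 0 < \<epsilon> \<and> ennreal \<epsilon> \<le> ediam TYPE('a)}.
        ennreal (young_inv \<phi> (1 / measure m (cball x \<epsilon>))) \<partial>lborel)"
  proof (rule nn_integral_mono)
    fix e :: real
    show "ennreal (3 / 4) * (\<Sum>k\<le>n. ennreal (c k * indicator {0<..<rad k x} e))
      \<le> ennreal (young_inv \<phi> (1 / measure m (cball x e)))
        * indicator {\<epsilon>. 0 < \<epsilon> \<and> ennreal \<epsilon> \<le> ediam TYPE('a)} e"
    proof (cases "0 < e \<and> e \<le> diam")
      case True
      have "(\<Sum>k\<le>n. ennreal (c k * indicator {0<..<rad k x} e))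
          = ennreal (\<Sum>k\<le>n. c k * indicator {0<..<rad k x} e)"
        using c_pos by (intro sum_ennreal) (auto simp: less_imp_le)
      then have "ennreal (3 / 4) * (\<Sum>k\<le>n. ennreal (c k * indicator {0<..<rad k x} e))
          = ennreal (3 / 4 * (\<Sum>k\<le>n. c k * indicator {0<..<rad k x} e))"
        by (simp only:) (rule ennreal_mult'[symmetric], simp)
      also have "\<dots> \<le> ennreal (young_inv \<phi> (1 / measure m (cball x e)))"
        using sum_c_below_rad[of e x n] True by (intro ennreal_leI) auto
      finally show ?thesis using True by (simp add: ediam_eq diam_nonneg)
    next
      case False
      \<comment> \<open>Outside the domain of integration all terms vanish, since no radius exceeds
        the diameter.\<close>
      then have "e \<notin> {0<..<rad k x}" for k using rad_le_diam[of k x] by auto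
      then show ?thesis by simp
    qed
  qed
  also have "\<dots> \<le> majorizing_sup \<phi> m"
    unfolding majorizing_sup_def by (rule SUP_upper) simp
  also have "\<dots> = ennreal S" by (rule majorizing_sup_eq)
  finally show ?thesis using S_nonneg by simp
qed

lemma c_rad_le: "c k * rad k x \<le> 4 / 3 * S"
proof -
  have "c k * rad k x \<le> (\<Sum>i\<le>k. c i * rad i x)"
    by (rule member_le_sum) (auto intro!: mult_nonneg_nonneg rad_nonneg less_imp_le[OF c_pos])
  then show ?thesis using sum_c_rad[where n = k and x = x] by simp
qed

text \<open>The product of level and radius stays bounded while the levels grow like 4 to the
  k.\<close>

lemma rad_tendsto_0: "(\<lambda>k. rad k x) \<longlonglongrightarrow> 0"
proof (rule tendsto_sandwich[of "\<lambda>_. 0"])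
  show "\<forall>\<^sub>F k in sequentially. rad k x \<le> 4 / 3 * S / c 0 * (1 / 4) ^ k"
    using c_rad_le[of _ x] c_pos[of 0]
    by (intro always_eventually) (auto simp: c_def field_simps)
  show "(\<lambda>k. 4 / 3 * S / c 0 * (1 / 4) ^ k) \<longlonglongrightarrow> 0"
    by (intro tendsto_mult_right_zero LIMSEQ_power_zero) simp
qed (use rad_nonneg in auto)

section \<open>Separability of the index space\<close>

text \<open>At a level where all radii are below e / 2, balls around e-separated points are disjoint
  and each has mass at least 1 / \<phi>(c k). This bounds the number of such points, and a separated
  set of largest size is a net.\<close>

lemma finite_net:
  assumes "0 < e"
  shows "\<exists>F. finite F \<and> (\<forall>x::'a. \<exists>y\<in>F. dist x y < e)"
proof -
  have "\<forall>\<^sub>F k in sequentially. 4 / 3 * S / c 0 * (1 / 4) ^ k < e / 2"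
    by (rule order_tendstoD[OF tendsto_mult_right_zero[OF LIMSEQ_power_zero]]) (use assms in auto)
  then obtain k where k: "4 / 3 * S / c 0 * (1 / 4) ^ k < e / 2"
    by (auto simp: eventually_sequentially)
  define \<rho> where "\<rho> = 4 / 3 * S / c k"
  have "\<rho> < e / 2" using k c_pos[of 0] by (auto simp: \<rho>_def c_def field_simps)
  have rad: "rad k x \<le> \<rho>" for x using c_rad_le[of k x] c_pos[of k] by (simp add: \<rho>_def field_simps)
  define sep where "sep F \<longleftrightarrow> finite F \<and> (\<forall>x\<in>F. \<forall>y\<in>F. x \<noteq> y \<longrightarrow> e \<le> dist x y)" for F :: "'a set"
  have "real (card F) \<le> \<phi> (c k)" if "sep F" for F
  proof -
    have fin: "finite F" using that by (simp add: sep_def)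
    have "disjoint_family_on (\<lambda>x. cball x \<rho>) F"
      unfolding disjoint_family_on_def
    proof (intro ballI impI)
      fix x y assume xy: "x \<in> F" "y \<in> F" "x \<noteq> y"
      have "False" if "dist x z \<le> \<rho>" "dist y z \<le> \<rho>" for z
        using that dist_triangle2[of x y z] \<open>\<rho> < e / 2\<close> \<open>sep F\<close> xy by (force simp: sep_def)
      then show "cball x \<rho> \<inter> cball y \<rho> = {}" by auto
    qed
    then have "measure m (\<Union>x\<in>F. cball x \<rho>) = (\<Sum>x\<in>F. measure m (cball x \<rho>))"
      using fin by (intro finite_measure_finite_Union) auto
    then have "(\<Sum>x\<in>F. measure m (cball x \<rho>)) \<le> 1" by (metis prob_le_1)
    then have "\<phi> (c k) * (\<Sum>x\<in>F. measure m (cball x \<rho>)) \<le> \<phi> (c k)"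
      using phi_c_ge_1[of k] by (simp add: mult_left_le)
    moreover have "1 \<le> \<phi> (c k) * measure m (cball x \<rho>)" for x
    proof -
      have "\<phi> (c k) * measure m (cball x (rad k x)) \<le> \<phi> (c k) * measure m (cball x \<rho>)"
        using phi_c_ge_1[of k] rad by (intro mult_left_mono finite_measure_mono subset_cball) auto
      then show ?thesis using measure_cball_rad[of k x] by simp
    qed
    then have "(\<Sum>x\<in>F. 1) \<le> (\<Sum>x\<in>F. \<phi> (c k) * measure m (cball x \<rho>))" by (intro sum_mono) auto
    ultimately show ?thesis by (simp add: sum_distrib_left)
  qed
  then have "\<forall>F. sep F \<longrightarrow> card F < nat \<lfloor>\<phi> (c k)\<rfloor> + 1" by (auto simp: le_nat_floor less_Suc_eq_le)
  moreover have "sep {}" by (simp add: sep_def)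
  ultimately obtain F where F: "sep F" "\<And>G. sep G \<Longrightarrow> card G \<le> card F"
    using ex_has_greatest_nat[of sep "{}" card] by blast
  \<comment> \<open>A point at distance at least e from all of F could be added to it, against the
    maximality of its size.\<close>
  have "\<exists>y\<in>F. dist x y < e" for x
  proof (rule ccontr)
    assume *: "\<not> (\<exists>y\<in>F. dist x y < e)"
    then have "x \<notin> F" using assms by auto
    have "sep (insert x F)" using F(1) * by (auto simp: sep_def not_less dist_commute)
    then show False using F(2)[of "insert x F"] \<open>x \<notin> F\<close> F(1) by (simp add: sep_def)
  qed
  then show ?thesis using F(1) by (auto simp: sep_def)
qed

lemma countable_dense: "\<exists>D. countable D \<and> (\<forall>x::'a. \<forall>e>0. \<exists>y\<in>D. dist x y < e)"
proof -
  have "\<forall>n. \<exists>F. finite F \<and> (\<forall>x::'a. \<exists>y\<in>F. dist x y < 1 / real (Suc n))"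
    by (intro allI finite_net) simp
  then obtain F where F: "\<And>n. finite (F n)" "\<And>n x. \<exists>y\<in>F n. dist (x::'a) y < 1 / real (Suc n)"
    by metis
  show ?thesis
  proof (intro exI[of _ "\<Union>n. F n"] conjI allI impI)
    show "countable (\<Union>n. F n)" using F(1) by (intro countable_UN) (auto intro: countable_finite)
    fix x :: 'a and e :: real assume "0 < e"
    then obtain n where "1 / real (Suc n) < e" using nat_approx_posE by blast
    then show "\<exists>y\<in>\<Union>n. F n. dist x y < e" using F(2)[of n x] by (fastforce intro: less_trans)
  qed
qed

lemma dist_const_measurable [measurable]: "(\<lambda>x. dist x y) \<in> borel_measurable m"
proof -
  have "(\<lambda>x. dist x y) \<in> borel_measurable borel"
    by (intro borel_measurable_continuous_onI continuous_intros)
  then show ?thesis using measurable_cong_sets[OF sets_borel refl] by blast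
qed

text \<open>Measurability is meant for the product \<sigma>-algebra, where continuity alone does not
  suffice. A countable dense set turns each sublevel set into a countable union of sets defined by
  distances to fixed points.\<close>

lemma dist_measurable [measurable]: "(\<lambda>p. dist (fst p) (snd p)) \<in> borel_measurable (m \<Otimes>\<^sub>M m)"
proof (rule borel_measurable_iff_less[THEN iffD2], intro allI)
  fix a :: real
  obtain D where D: "countable D" "\<And>x e. 0 < e \<Longrightarrow> \<exists>y\<in>D. dist (x::'a) y < e"
    using countable_dense by metis
  have "(dist x y < a) = (\<exists>d\<in>D. dist x d + dist y d < a)" for x y :: 'a
  proof
    assume "dist x y < a"
    \<comment> \<open>With this choice dist x d + dist y d \<le> dist x y + 2 dist x d < a.\<close>
    then obtain d where d: "d \<in> D" "dist x d < (a - dist x y) / 2"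
      using D(2)[of "(a - dist x y) / 2" x] by auto
    then show "\<exists>d\<in>D. dist x d + dist y d < a"
      using dist_triangle3[of y d x] by (intro bexI[of _ d]) (auto simp: dist_commute)
  next
    assume "\<exists>d\<in>D. dist x d + dist y d < a"
    then show "dist x y < a" using dist_triangle2[of x y] by (meson le_less_trans)
  qed
  then have "{w \<in> space (m \<Otimes>\<^sub>M m). dist (fst w) (snd w) < a}
      = (\<Union>d\<in>D. {w \<in> space (m \<Otimes>\<^sub>M m). dist (fst w) d + dist (snd w) d < a})"
    by auto
  also have "\<dots> \<in> sets (m \<Otimes>\<^sub>M m)"
    using D(1) by (intro sets.countable_UN'') measurable
  finally show "{w \<in> space (m \<Otimes>\<^sub>M m). dist (fst w) (snd w) < a} \<in> sets (m \<Otimes>\<^sub>M m)" .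
qed

section \<open>Averages over balls\<close>

text \<open>The averaging measure of scale \<open>k\<close> around \<open>x\<close>.\<close>

definition law :: "nat \<Rightarrow> 'a \<Rightarrow> 'a measure" where
  "law k x = uniform_measure m (cball x (rad k x))"

lemma sets_law [simp, measurable_cong]: "sets (law k x) = sets m"
  by (simp add: law_def)

lemma space_law [simp]: "space (law k x) = UNIV"
  by (simp add: law_def space_UNIV)

lemma measure_cball_rad_pos: "0 < measure m (cball x (rad k x))"
  using measure_cball_rad[of k x] phi_c_ge_1[of k]
  by (cases "measure m (cball x (rad k x)) = 0") (auto simp: less_le)

lemma prob_space_law: "prob_space (law k x)"
  unfolding law_def using measure_cball_rad_pos[of x k]
  by (intro prob_space_uniform_measure) (auto simp: emeasure_eq_measure)

text \<open>Under \<open>law k x\<close> pointwise estimates have to be checked on the ball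
  only.\<close>

lemma AE_law: "(\<And>u. dist x u \<le> rad k x \<Longrightarrow> Q u) \<Longrightarrow> AE u in law k x. Q u"
  unfolding law_def by (rule AE_uniform_measureI) auto

lemma nn_integral_law:
  assumes "g \<in> borel_measurable m"
  shows "(\<integral>\<^sup>+u. g u \<partial>law k x)
    = (\<integral>\<^sup>+u. g u * indicator (cball x (rad k x)) u \<partial>m) / emeasure m (cball x (rad k x))"
  unfolding law_def by (rule nn_integral_uniform_measure) (use assms in auto)

lemma emeasure_law_UNIV [simp]: "emeasure (law k x) UNIV = 1"
  using prob_space.emeasure_space_1[OF prob_space_law, of k x] by simp

text \<open>The ball has mass at least 1 / \<phi>(c k), so the density with respect to m is at most
  \<phi>(c k). The bound no longer depends on \<open>x\<close>.\<close>

lemma nn_integral_law_le: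
  assumes [measurable]: "g \<in> borel_measurable m"
  shows "(\<integral>\<^sup>+u. g u \<partial>law k x) \<le> ennreal (\<phi> (c k)) * (\<integral>\<^sup>+u. g u \<partial>m)"
proof -
  let ?M = "measure m (cball x (rad k x))"
  have "(\<integral>\<^sup>+u. g u \<partial>law k x) \<le> (\<integral>\<^sup>+u. g u \<partial>m) / ennreal ?M"
    unfolding nn_integral_law[OF assms] emeasure_eq_measure
    by (intro divide_right_mono_ennreal nn_integral_mono) (auto simp: indicator_def)
  also have "\<dots> = ennreal (1 / ?M) * (\<integral>\<^sup>+u. g u \<partial>m)"
    using measure_cball_rad_pos[of x k]
    by (simp add: divide_ennreal_def inverse_ennreal mult.commute inverse_eq_divide)
  also have "\<dots> \<le> ennreal (\<phi> (c k)) * (\<integral>\<^sup>+u. g u \<partial>m)"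
    using measure_cball_rad[of k x] measure_cball_rad_pos[of x k]
    by (intro mult_right_mono ennreal_leI) (auto simp: field_simps)
  finally show ?thesis .
qed

text \<open>The ball moves with the parameter, so the average is written as a quotient of two
  integrals against the fixed measure m, restricted to a jointly measurable set.\<close>

lemma nn_integral_law_measurable:
  assumes f [measurable]: "f \<in> N \<rightarrow>\<^sub>M m"
    and g [measurable]: "(\<lambda>(w, v). g w v) \<in> borel_measurable (N \<Otimes>\<^sub>M m)"
  shows "(\<lambda>w. \<integral>\<^sup>+v. g w v \<partial>law k (f w)) \<in> borel_measurable N"
proof -
  have [measurable]: "(\<lambda>p. dist (f (fst p)) (snd p)) \<in> borel_measurable (N \<Otimes>\<^sub>M m)"
  proof -
    have "(\<lambda>p. (f (fst p), snd p)) \<in> N \<Otimes>\<^sub>M m \<rightarrow>\<^sub>M m \<Otimes>\<^sub>M m" by measurable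
    from measurable_compose[OF this dist_measurable] show ?thesis by simp
  qed
  let ?B = "{p \<in> space (N \<Otimes>\<^sub>M m). dist (f (fst p)) (snd p) \<le> rad k (f (fst p))}"
  have [measurable]: "?B \<in> sets (N \<Otimes>\<^sub>M m)" by measurable
  have "(\<lambda>w. (\<integral>\<^sup>+v. g w v * indicator ?B (w, v) \<partial>m) / (\<integral>\<^sup>+v. indicator ?B (w, v) \<partial>m))
      \<in> borel_measurable N"
    by measurable
  also have "?this \<longleftrightarrow> ?thesis"
  proof (rule measurable_cong)
    fix w assume w: "w \<in> space N"
    have ind: "indicator ?B (w, v) = (indicator (cball (f w) (rad k (f w))) v :: ennreal)" for v
      using w by (auto simp: indicator_def space_pair_measure space_UNIV)
    have "g w \<in> borel_measurable m" using measurable_Pair2[OF g w] by simp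
    from nn_integral_law[OF this]
    show "(\<integral>\<^sup>+v. g w v * indicator ?B (w, v) \<partial>m) / (\<integral>\<^sup>+v. indicator ?B (w, v) \<partial>m)
        = (\<integral>\<^sup>+v. g w v \<partial>law k (f w))"
      by (simp add: ind)
  qed
  finally show ?thesis .
qed

text \<open>Points and values are separate functions of \<open>w\<close>, so that the lemma serves a
  fixed path and the process alike.\<close>

lemma energy_measurable:
  assumes [measurable]: "f \<in> N \<rightarrow>\<^sub>M m" "g \<in> N \<rightarrow>\<^sub>M m" "F \<in> borel_measurable N" "G \<in> borel_measurable N"
  shows "(\<lambda>w. ennreal (\<phi> (\<bar>F w - G w\<bar> / dist (f w) (g w)))) \<in> borel_measurable N"
proof -
  have "(\<lambda>w. (f w, g w)) \<in> N \<rightarrow>\<^sub>M m \<Otimes>\<^sub>M m" by measurable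
  from measurable_compose[OF this dist_measurable]
  have [measurable]: "(\<lambda>w. dist (f w) (g w)) \<in> borel_measurable N" by simp
  show ?thesis
    by (intro measurable_compose[OF _ measurable_ennreal] young_function_measurable[OF young]) auto
qed

section \<open>Chaining along a single path\<close>

text \<open>The radius terms accumulated after \<open>n\<close> steps. Coefficient 2 on the current
  scale and 6 on every earlier one is the pattern that \<open>det_bound_step\<close>
  reproduces.\<close>

definition det_bound :: "nat \<Rightarrow> 'a \<Rightarrow> real" where
  "det_bound n x = (\<Sum>i<n. 6 * c i * rad i x) + 2 * c n * rad n x"

lemma det_bound_nonneg: "0 \<le> det_bound n x"
  unfolding det_bound_def using c_pos rad_nonneg
  by (intro add_nonneg_nonneg sum_nonneg mult_nonneg_nonneg) (auto simp: less_imp_le)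

text \<open>As c(n + 1) = 4 c(n), the new term raises the last coefficient from 2 to 6. Replacing
  each rad i u by rad i x + rad (Suc n) x then costs a multiple 6 \<Sum> c(i) = 2 (c(n + 1) - c(0))
  of the new radius, within its coefficient 2 c(n + 1).\<close>

lemma det_bound_step:
  assumes "dist x u \<le> rad (Suc n) x"
  shows "rad n u * c (Suc n) + det_bound n u \<le> det_bound (Suc n) x"
proof -
  have "rad n u * c (Suc n) + det_bound n u = (\<Sum>i<Suc n. 6 * c i * rad i u)"
    by (simp add: det_bound_def c_Suc)
  also have "\<dots> \<le> (\<Sum>i<Suc n. 6 * c i * rad i x + 6 * c i * rad (Suc n) x)"
  proof (rule sum_mono)
    fix i
    have "rad i u \<le> rad i x + rad (Suc n) x" using rad_lipschitz[of i u x] assms by simp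
    from mult_left_mono[OF this, of "6 * c i"]
    show "6 * c i * rad i u \<le> 6 * c i * rad i x + 6 * c i * rad (Suc n) x"
      using c_pos[of i] by (simp add: algebra_simps)
  qed
  also have "\<dots> = (\<Sum>i<Suc n. 6 * c i * rad i x) + 2 * (3 * (\<Sum>i<Suc n. c i)) * rad (Suc n) x"
    by (simp add: sum.distrib sum_distrib_left sum_distrib_right algebra_simps del: sum.lessThan_Suc)
  also have "\<dots> \<le> det_bound (Suc n) x"
    unfolding det_bound_def sum_c using c_pos[of 0] rad_nonneg[of "Suc n" x]
    by (intro add_left_mono mult_right_mono) auto
  finally show ?thesis .
qed

lemma det_bound_le: "det_bound n x \<le> 8 * S"
proof -
  have "det_bound n x \<le> 6 * (\<Sum>i\<le>n. c i * rad i x)"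
    using c_pos[of n] rad_nonneg[of n x]
    by (simp add: det_bound_def sum_distrib_left mult.assoc lessThan_Suc_atMost[symmetric])
  also have "\<dots> \<le> 6 * (4 / 3 * S)" by (intro mult_left_mono sum_c_rad) auto
  finally show ?thesis by simp
qed

text \<open>For u = v division by zero gives 0, and \<phi>(0) = 0, in accordance with the convention
  0/0 = 0.\<close>

definition energy :: "('a \<Rightarrow> real) \<Rightarrow> 'a \<Rightarrow> 'a \<Rightarrow> ennreal" where
  "energy f u v = ennreal (\<phi> (\<bar>f u - f v\<bar> / dist u v))"

text \<open>Unlike the distance of f(u) from the mean of f, this is meaningful for paths that are
  not integrable.\<close>

definition mean_dev :: "('a \<Rightarrow> real) \<Rightarrow> 'a \<Rightarrow> ennreal" where
  "mean_dev f u = (\<integral>\<^sup>+w. ennreal \<bar>f u - f w\<bar> \<partial>m)"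

definition local_dev :: "nat \<Rightarrow> ('a \<Rightarrow> real) \<Rightarrow> 'a \<Rightarrow> ennreal" where
  "local_dev k f u = (\<integral>\<^sup>+v. ennreal \<bar>f u - f v\<bar> \<partial>law k u)"

text \<open>The part of the error between scales \<open>k\<close> and \<open>k + 1\<close> that is
  common to all starting points.\<close>

definition level_energy :: "nat \<Rightarrow> ('a \<Rightarrow> real) \<Rightarrow> ennreal" where
  "level_energy k f = (\<integral>\<^sup>+u. ennreal (rad k u) * (\<integral>\<^sup>+v. energy f u v \<partial>law k u) \<partial>m)"

context
  fixes f :: "'a \<Rightarrow> real"
  assumes f [measurable]: "f \<in> borel_measurable m"
begin

lemma mean_dev_measurable [measurable]: "mean_dev f \<in> borel_measurable m"
  unfolding mean_dev_def by measurable

lemma mean_dev_triangle: "mean_dev f u \<le> ennreal \<bar>f u - f v\<bar> + mean_dev f v"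
proof -
  have "mean_dev f u \<le> (\<integral>\<^sup>+w. ennreal \<bar>f u - f v\<bar> + ennreal \<bar>f v - f w\<bar> \<partial>m)"
    unfolding mean_dev_def by (intro nn_integral_mono) (simp flip: ennreal_plus)
  also have "\<dots> = ennreal \<bar>f u - f v\<bar> + mean_dev f v"
    unfolding mean_dev_def by (subst nn_integral_add) (auto simp: emeasure_space_1)
  finally show ?thesis .
qed

text \<open>Reduces an increment to one estimate at each endpoint, whence the factor 2 between 16
  and 32.\<close>

lemma increment_le_mean_dev: "ennreal \<bar>f u - f v\<bar> \<le> mean_dev f u + mean_dev f v"
proof -
  have "ennreal \<bar>f u - f v\<bar> = (\<integral>\<^sup>+w. ennreal \<bar>f u - f v\<bar> \<partial>m)"
    by (simp add: emeasure_space_1)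
  also have "\<dots> \<le> (\<integral>\<^sup>+w. ennreal \<bar>f u - f w\<bar> + ennreal \<bar>f v - f w\<bar> \<partial>m)"
    by (intro nn_integral_mono) (simp flip: ennreal_plus)
  also have "\<dots> = mean_dev f u + mean_dev f v"
    unfolding mean_dev_def by (subst nn_integral_add) auto
  finally show ?thesis .
qed

text \<open>\<open>mean_dev_triangle\<close> averaged over \<open>v\<close>; this passes from a
  point to its ball of scale \<open>k\<close>.\<close>

lemma mean_dev_le: "mean_dev f u \<le> local_dev k f u + (\<integral>\<^sup>+v. mean_dev f v \<partial>law k u)"
proof -
  have "mean_dev f u = (\<integral>\<^sup>+v. mean_dev f u \<partial>law k u)" by simp
  also have "\<dots> \<le> (\<integral>\<^sup>+v. ennreal \<bar>f u - f v\<bar> + mean_dev f v \<partial>law k u)"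
    by (intro nn_integral_mono mean_dev_triangle)
  also have "\<dots> = local_dev k f u + (\<integral>\<^sup>+v. mean_dev f v \<partial>law k u)"
    unfolding local_dev_def by (rule nn_integral_add) measurable
  finally show ?thesis .
qed

lemma energy_pair_measurable: "(\<lambda>(u, v). energy f u v) \<in> borel_measurable (m \<Otimes>\<^sub>M m)"
  unfolding energy_def split_beta by (intro energy_measurable) measurable

lemma energy_measurable_right: "energy f u \<in> borel_measurable m"
  using measurable_Pair2[OF energy_pair_measurable, of u] by (simp add: space_UNIV)

lemma weighted_energy_measurable [measurable]:
  "(\<lambda>u. ennreal (rad k u) * (\<integral>\<^sup>+v. energy f u v \<partial>law k u)) \<in> borel_measurable m"
  using nn_integral_law_measurable[OF measurable_ident energy_pair_measurable, of k] by simp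

text \<open>\<open>young_ineq_increment\<close> averaged over the ball, where distances to the
  centre are at most the radius.\<close>

lemma local_dev_le:
  assumes "0 < y"
  shows "local_dev k f u \<le> ennreal (rad k u * y)
    + ennreal (y / \<phi> y) * (ennreal (rad k u) * (\<integral>\<^sup>+v. energy f u v \<partial>law k u))"
proof -
  have p: "0 < \<phi> y" by (rule young_function_pos[OF young assms])
  have [measurable]: "energy f u \<in> borel_measurable m" by (rule energy_measurable_right)
  have "local_dev k f u \<le> (\<integral>\<^sup>+v. ennreal (rad k u * y) + ennreal (rad k u * y / \<phi> y) * energy f u v \<partial>law k u)"
    unfolding local_dev_def
  proof (intro nn_integral_mono_AE AE_law)
    fix v assume v: "dist u v \<le> rad k u"
    have "ennreal \<bar>f u - f v\<bar> \<le> ennreal (dist u v * y) + ennreal (dist u v * y / \<phi> y) * energy f u v"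
      unfolding energy_def by (rule young_ineq_increment[OF young assms])
    also have "\<dots> \<le> ennreal (rad k u * y) + ennreal (rad k u * y / \<phi> y) * energy f u v"
      using v p assms
      by (intro add_mono mult_right_mono ennreal_leI divide_right_mono) auto
    finally show "ennreal \<bar>f u - f v\<bar> \<le> \<dots>" .
  qed
  also have "\<dots> = ennreal (rad k u * y) + ennreal (rad k u * y / \<phi> y) * (\<integral>\<^sup>+v. energy f u v \<partial>law k u)"
    by (subst nn_integral_add) (auto simp: nn_integral_cmult)
  also have "ennreal (rad k u * y / \<phi> y) = ennreal (y / \<phi> y) * ennreal (rad k u)"
    using p assms by (subst ennreal_mult'[symmetric]) (auto simp: mult.commute)
  finally show ?thesis by (simp add: mult.assoc)
qed

text \<open>The error of passing from scale \<open>n\<close> to \<open>n + 1\<close> splits into a multiple of \<open>rad n\<close>, absorbed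
  by \<open>det_bound\<close>, and an energy term. The latter is averaged over a ball of mass at least
  \<open>1 / \<phi> (c (Suc n))\<close>, so it is bounded by its integral over the whole space, uniformly in \<open>x\<close>.\<close>

lemma chaining:
  "(\<integral>\<^sup>+u. mean_dev f u \<partial>law n x)
    \<le> (\<integral>\<^sup>+u. mean_dev f u \<partial>m) + (\<Sum>k<n. ennreal (c (Suc k)) * level_energy k f) + ennreal (det_bound n x)"
proof (induction n arbitrary: x)
  case 0
  \<comment> \<open>Since \<phi>(c 0) = 1, averaging at scale 0 loses no factor.\<close>
  have "(\<integral>\<^sup>+u. mean_dev f u \<partial>law 0 x) \<le> (\<integral>\<^sup>+u. mean_dev f u \<partial>m)"
    using nn_integral_law_le[of "mean_dev f" 0 x] by (simp add: phi_c0)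
  then show ?case by (simp add: add_increasing2)
next
  case (Suc n)
  \<comment> \<open>With this threshold the factor \<phi>(y) lost by averaging over
    \<open>law (Suc n) x\<close> cancels the 1 / \<phi>(y) of the convexity inequality.\<close>
  define y where "y = c (Suc n)"
  define K where "K = (\<integral>\<^sup>+u. mean_dev f u \<partial>m) + (\<Sum>k<n. ennreal (c (Suc k)) * level_energy k f)"
  define H where "H u = ennreal (rad n u) * (\<integral>\<^sup>+v. energy f u v \<partial>law n u)" for u
  have [measurable]: "H \<in> borel_measurable m" unfolding H_def by measurable
  have y: "0 < y" and p: "0 < \<phi> y" using c_pos young_function_pos[OF young] by (auto simp: y_def)
  have "(\<integral>\<^sup>+u. mean_dev f u \<partial>law (Suc n) x)
      \<le> (\<integral>\<^sup>+u. ennreal (y / \<phi> y) * H u + (K + ennreal (det_bound (Suc n) x)) \<partial>law (Suc n) x)"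
  proof (intro nn_integral_mono_AE AE_law)
    fix u assume u: "dist x u \<le> rad (Suc n) x"
    have "mean_dev f u \<le> (ennreal (rad n u * y) + ennreal (y / \<phi> y) * H u)
        + (K + ennreal (det_bound n u))"
      unfolding H_def K_def
      by (rule order_trans[OF mean_dev_le[of u n]] add_mono local_dev_le[OF y] Suc.IH)+
    also have "\<dots> = ennreal (y / \<phi> y) * H u + (K + ennreal (rad n u * y + det_bound n u))"
      using y rad_nonneg[of n u] det_bound_nonneg[of n u] by (simp add: ac_simps)
    also have "\<dots> \<le> ennreal (y / \<phi> y) * H u + (K + ennreal (det_bound (Suc n) x))"
      using det_bound_step[OF u] by (intro add_left_mono ennreal_leI) (simp add: y_def)
    finally show "mean_dev f u \<le> \<dots>" .
  qed
  also have "\<dots> = ennreal (y / \<phi> y) * (\<integral>\<^sup>+u. H u \<partial>law (Suc n) x) + (K + ennreal (det_bound (Suc n) x))"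
    by (subst nn_integral_add) (auto simp: nn_integral_cmult)
  also have "\<dots> \<le> ennreal (y / \<phi> y) * (ennreal (\<phi> y) * (\<integral>\<^sup>+u. H u \<partial>m)) + (K + ennreal (det_bound (Suc n) x))"
    unfolding y_def by (intro add_right_mono mult_left_mono nn_integral_law_le) auto
  also have "ennreal (y / \<phi> y) * (ennreal (\<phi> y) * (\<integral>\<^sup>+u. H u \<partial>m)) = ennreal y * level_energy n f"
    using y p by (simp add: mult.assoc[symmetric] ennreal_mult'[symmetric] level_energy_def H_def)
  finally show ?case by (simp add: K_def y_def ac_simps)
qed

end

section \<open>Jointly measurable modifications\<close>

text \<open>The convexity inequality at threshold \<open>c 0\<close>, where \<phi> equals 1: both of
  its terms contribute \<open>c 0\<close> times the distance.\<close>

lemma mean_increment_le: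
  assumes "prob_space P" and [measurable]: "X u \<in> borel_measurable P" "X v \<in> borel_measurable P"
    and le1: "(\<integral>\<^sup>+\<omega>. energy (\<lambda>t. X t \<omega>) u v \<partial>P) \<le> 1"
  shows "(\<integral>\<^sup>+\<omega>. ennreal \<bar>X u \<omega> - X v \<omega>\<bar> \<partial>P) \<le> ennreal (2 * c 0 * dist u v)"
proof -
  interpret P: prob_space P by fact
  have [measurable]: "(\<lambda>\<omega>. energy (\<lambda>t. X t \<omega>) u v) \<in> borel_measurable P"
    unfolding energy_def
    by (intro measurable_compose[OF _ measurable_ennreal] young_function_measurable[OF young]) auto
  have "(\<integral>\<^sup>+\<omega>. ennreal \<bar>X u \<omega> - X v \<omega>\<bar> \<partial>P)
      \<le> (\<integral>\<^sup>+\<omega>. ennreal (dist u v * c 0) + ennreal (dist u v * c 0) * energy (\<lambda>t. X t \<omega>) u v \<partial>P)"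
    using young_ineq_increment[OF young c_pos[of 0], where f = "\<lambda>t. X t _"]
    by (intro nn_integral_mono) (simp add: phi_c0 energy_def)
  also have "\<dots> = ennreal (dist u v * c 0) + ennreal (dist u v * c 0) * (\<integral>\<^sup>+\<omega>. energy (\<lambda>t. X t \<omega>) u v \<partial>P)"
    by (subst nn_integral_add) (auto simp: nn_integral_cmult P.emeasure_space_1)
  also have "\<dots> \<le> ennreal (dist u v * c 0) + ennreal (dist u v * c 0) * 1"
    by (intro add_left_mono mult_left_mono le1) simp
  also have "\<dots> = ennreal (2 * c 0 * dist u v)"
    using c_pos[of 0] by (subst mult_1_right, subst ennreal_plus[symmetric]) auto
  finally show ?thesis .
qed

text \<open>Replacing \<open>u\<close> by the first point of a dense sequence within distance 1 /
  2^n gives a jointly measurable process. The mean errors are summable in \<open>n\<close>, so for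
  each \<open>u\<close> the approximations converge almost surely to X(u).\<close>

lemma measurable_modification:
  fixes X :: "'a \<Rightarrow> 'w \<Rightarrow> real"
  assumes X [measurable]: "\<And>t. X t \<in> borel_measurable P"
    and inc: "\<And>s t. (\<integral>\<^sup>+\<omega>. ennreal \<bar>X s \<omega> - X t \<omega>\<bar> \<partial>P) \<le> ennreal (C * dist s t)"
    and "0 \<le> C"
  obtains Y where "(\<lambda>(\<omega>, u). Y u \<omega>) \<in> borel_measurable (P \<Otimes>\<^sub>M m)"
    and "\<And>u. AE \<omega> in P. Y u \<omega> = X u \<omega>"
proof -
  obtain D where D: "countable D" "\<And>x e. 0 < e \<Longrightarrow> \<exists>y\<in>D. dist (x::'a) y < e"
    using countable_dense by metis
  define d where "d = from_nat_into D"
  define idx where "idx n u = (LEAST i. dist u (d i) < (1 / 2) ^ n)" for n :: nat and u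
  have [measurable]: "idx n \<in> m \<rightarrow>\<^sub>M count_space UNIV" for n
    unfolding idx_def by measurable
  have idx: "dist u (d (idx n u)) < (1 / 2) ^ n" for n u
  proof -
    obtain y where y: "y \<in> D" "dist u y < (1 / 2) ^ n" using D(2)[of "(1 / 2) ^ n" u] by auto
    then have "dist u (d (to_nat_on D y)) < (1 / 2) ^ n" using D(1) by (simp add: d_def)
    then show ?thesis unfolding idx_def by (rule LeastI)
  qed
  define Z where "Z n u \<omega> = X (d (idx n u)) \<omega>" for n u \<omega>
  \<comment> \<open>Where the limit does not exist, \<open>lim\<close> returns a fixed unspecified
    real; for each \<open>u\<close> this concerns a null set only.\<close>
  define Y where "Y u \<omega> = lim (\<lambda>n. Z n u \<omega>)" for u \<omega>
  show thesis
  proof (rule that[of Y])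
    have [measurable]: "(\<lambda>p. Z n (snd p) (fst p)) \<in> borel_measurable (P \<Otimes>\<^sub>M m)" for n
      unfolding Z_def
      by (rule measurable_compose_countable[where f = "\<lambda>i p. X (d i) (fst p)"]) measurable
    show "(\<lambda>(\<omega>, u). Y u \<omega>) \<in> borel_measurable (P \<Otimes>\<^sub>M m)"
      unfolding Y_def split_beta by measurable
    fix u
    have [measurable]: "Z n u \<in> borel_measurable P" for n unfolding Z_def by measurable
    \<comment> \<open>A finite expected total error makes the series of errors finite almost surely,
      so its terms tend to 0.\<close>
    have "(\<integral>\<^sup>+\<omega>. (\<Sum>n. ennreal \<bar>Z n u \<omega> - X u \<omega>\<bar>) \<partial>P)
        = (\<Sum>n. \<integral>\<^sup>+\<omega>. ennreal \<bar>Z n u \<omega> - X u \<omega>\<bar> \<partial>P)"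
      by (rule nn_integral_suminf) measurable
    also have "\<dots> \<le> (\<Sum>n. ennreal (C * (1 / 2) ^ n))"
    proof (rule suminf_le)
      fix n
      have "C * dist (d (idx n u)) u \<le> C * (1 / 2) ^ n"
        using idx[of u n] \<open>0 \<le> C\<close> by (intro mult_left_mono) (auto simp: dist_commute)
      then show "(\<integral>\<^sup>+\<omega>. ennreal \<bar>Z n u \<omega> - X u \<omega>\<bar> \<partial>P) \<le> ennreal (C * (1 / 2) ^ n)"
        unfolding Z_def by (intro order_trans[OF inc] ennreal_leI)
    qed auto
    also have "\<dots> = ennreal (\<Sum>n. C * (1 / 2) ^ n)"
      using \<open>0 \<le> C\<close> by (intro suminf_ennreal2) (auto intro!: summable_mult summable_geometric)
    finally have "(\<integral>\<^sup>+\<omega>. (\<Sum>n. ennreal \<bar>Z n u \<omega> - X u \<omega>\<bar>) \<partial>P) \<noteq> \<infinity>"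
      by (auto simp: top_unique)
    then have "AE \<omega> in P. (\<Sum>n. ennreal \<bar>Z n u \<omega> - X u \<omega>\<bar>) \<noteq> \<infinity>"
      by (intro nn_integral_noteq_infinite) measurable
    then show "AE \<omega> in P. Y u \<omega> = X u \<omega>"
    proof eventually_elim
      fix \<omega> assume "(\<Sum>n. ennreal \<bar>Z n u \<omega> - X u \<omega>\<bar>) \<noteq> \<infinity>"
      then have "summable (\<lambda>n. \<bar>Z n u \<omega> - X u \<omega>\<bar>)" by (intro summable_suminf_not_top) auto
      then have "(\<lambda>n. \<bar>Z n u \<omega> - X u \<omega>\<bar>) \<longlonglongrightarrow> 0" by (rule summable_LIMSEQ_zero)
      then have "(\<lambda>n. Z n u \<omega>) \<longlonglongrightarrow> X u \<omega>" by (simp add: tendsto_rabs_zero_iff LIM_zero_iff)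
      then show "Y u \<omega> = X u \<omega>" unfolding Y_def by (rule limI)
    qed
  qed
qed

section \<open>Expectations of the path bounds\<close>

context
  fixes P :: "'w measure" and Y :: "'a \<Rightarrow> 'w \<Rightarrow> real"
  assumes prob_P: "prob_space P"
    and Y [measurable]: "(\<lambda>(\<omega>, u). Y u \<omega>) \<in> borel_measurable (P \<Otimes>\<^sub>M m)"
    and energy_le_1: "\<And>u v. (\<integral>\<^sup>+\<omega>. energy (\<lambda>t. Y t \<omega>) u v \<partial>P) \<le> 1"
begin

interpretation P: prob_space P by (rule prob_P)

lemma path_measurable: "\<omega> \<in> space P \<Longrightarrow> (\<lambda>u. Y u \<omega>) \<in> borel_measurable m"
  using measurable_Pair2[OF Y] by simp

lemma variable_measurable [measurable]: "Y u \<in> borel_measurable P"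
  using measurable_Pair1[OF Y, of u] by (simp add: space_UNIV)

lemma process_measurable [measurable (raw)]:
  assumes "a \<in> N \<rightarrow>\<^sub>M P" "b \<in> N \<rightarrow>\<^sub>M m"
  shows "(\<lambda>w. Y (b w) (a w)) \<in> borel_measurable N"
  using measurable_compose[OF measurable_Pair[OF assms] Y] by simp

lemma mean_process_increment_le:
  "(\<integral>\<^sup>+\<omega>. ennreal \<bar>Y u \<omega> - Y v \<omega>\<bar> \<partial>P) \<le> ennreal (2 * c 0 * dist u v)"
  by (rule mean_increment_le[OF prob_P _ _ energy_le_1]) measurable

lemma process_energy_measurable:
  assumes "a \<in> N \<rightarrow>\<^sub>M P" "b \<in> N \<rightarrow>\<^sub>M m" "b' \<in> N \<rightarrow>\<^sub>M m"
  shows "(\<lambda>w. energy (\<lambda>t. Y t (a w)) (b w) (b' w)) \<in> borel_measurable N"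
  unfolding energy_def by (intro energy_measurable process_measurable assms)

lemma weighted_process_energy_measurable [measurable]:
  "(\<lambda>(\<omega>, u). ennreal (rad k u) * (\<integral>\<^sup>+v. energy (\<lambda>t. Y t \<omega>) u v \<partial>law k u))
    \<in> borel_measurable (P \<Otimes>\<^sub>M m)"
proof -
  have "(\<lambda>p. \<integral>\<^sup>+v. energy (\<lambda>t. Y t (fst p)) (snd p) v \<partial>law k (snd p)) \<in> borel_measurable (P \<Otimes>\<^sub>M m)"
    by (rule nn_integral_law_measurable)
       (unfold split_beta, auto intro!: process_energy_measurable)
  then show ?thesis unfolding split_beta by measurable
qed

lemma level_energy_measurable [measurable]:
  "(\<lambda>\<omega>. level_energy k (\<lambda>t. Y t \<omega>)) \<in> borel_measurable P"
  unfolding level_energy_def by measurable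

text \<open>Tonelli moves the expectation innermost, where the moment hypothesis bounds it by 1, and
  \<open>law k u\<close> has mass 1.\<close>

lemma mean_level_energy_le:
  "(\<integral>\<^sup>+\<omega>. level_energy k (\<lambda>t. Y t \<omega>) \<partial>P) \<le> (\<integral>\<^sup>+u. ennreal (rad k u) \<partial>m)"
proof -
  interpret pair_sigma_finite P m ..
  have "(\<integral>\<^sup>+\<omega>. level_energy k (\<lambda>t. Y t \<omega>) \<partial>P)
      = (\<integral>\<^sup>+u. (\<integral>\<^sup>+\<omega>. ennreal (rad k u) * (\<integral>\<^sup>+v. energy (\<lambda>t. Y t \<omega>) u v \<partial>law k u) \<partial>P) \<partial>m)"
    unfolding level_energy_def
    by (rule Fubini'[symmetric]) measurable
  also have "\<dots> \<le> (\<integral>\<^sup>+u. ennreal (rad k u) \<partial>m)"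
  proof (rule nn_integral_mono)
    fix u
    interpret L: prob_space "law k u" by (rule prob_space_law)
    interpret PL: pair_sigma_finite P "law k u" ..
    have [measurable]: "(\<lambda>(\<omega>, v). energy (\<lambda>t. Y t \<omega>) u v) \<in> borel_measurable (P \<Otimes>\<^sub>M law k u)"
      unfolding split_beta by (intro process_energy_measurable) (auto simp: space_UNIV)
    have "(\<integral>\<^sup>+\<omega>. ennreal (rad k u) * (\<integral>\<^sup>+v. energy (\<lambda>t. Y t \<omega>) u v \<partial>law k u) \<partial>P)
        = ennreal (rad k u) * (\<integral>\<^sup>+\<omega>. (\<integral>\<^sup>+v. energy (\<lambda>t. Y t \<omega>) u v \<partial>law k u) \<partial>P)"
      by (rule nn_integral_cmult) (rule L.borel_measurable_nn_integral, measurable)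
    also have "(\<integral>\<^sup>+\<omega>. (\<integral>\<^sup>+v. energy (\<lambda>t. Y t \<omega>) u v \<partial>law k u) \<partial>P)
        = (\<integral>\<^sup>+v. (\<integral>\<^sup>+\<omega>. energy (\<lambda>t. Y t \<omega>) u v \<partial>P) \<partial>law k u)"
      by (rule PL.Fubini'[symmetric]) measurable
    also have "ennreal (rad k u) * \<dots> \<le> ennreal (rad k u) * (\<integral>\<^sup>+v. 1 \<partial>law k u)"
      by (intro mult_left_mono nn_integral_mono energy_le_1) simp
    finally show "(\<integral>\<^sup>+\<omega>. ennreal (rad k u) * (\<integral>\<^sup>+v. energy (\<lambda>t. Y t \<omega>) u v \<partial>law k u) \<partial>P)
        \<le> ennreal (rad k u)" by simp
  qed
  finally show ?thesis .
qed

text \<open>Since c(k + 1) = 4 c(k), the sum is at most four times the one in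
  \<open>sum_c_rad\<close>.\<close>

lemma mean_sum_level_energy_le:
  "(\<integral>\<^sup>+\<omega>. (\<Sum>k<n. ennreal (c (Suc k)) * level_energy k (\<lambda>t. Y t \<omega>)) \<partial>P) \<le> ennreal (16 / 3 * S)"
proof -
  have "(\<integral>\<^sup>+\<omega>. (\<Sum>k<n. ennreal (c (Suc k)) * level_energy k (\<lambda>t. Y t \<omega>)) \<partial>P)
      = (\<Sum>k<n. ennreal (c (Suc k)) * (\<integral>\<^sup>+\<omega>. level_energy k (\<lambda>t. Y t \<omega>) \<partial>P))"
    by (subst nn_integral_sum) (auto simp: nn_integral_cmult)
  also have "\<dots> \<le> (\<Sum>k<n. ennreal (c (Suc k)) * (\<integral>\<^sup>+u. ennreal (rad k u) \<partial>m))"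
    by (intro sum_mono mult_left_mono mean_level_energy_le) simp
  also have "\<dots> = (\<integral>\<^sup>+u. (\<Sum>k<n. ennreal (c (Suc k)) * ennreal (rad k u)) \<partial>m)"
    by (subst nn_integral_sum) (auto simp: nn_integral_cmult)
  also have "\<dots> \<le> (\<integral>\<^sup>+u. ennreal (16 / 3 * S) \<partial>m)"
  proof (rule nn_integral_mono)
    fix u
    have "(\<Sum>k<n. ennreal (c (Suc k)) * ennreal (rad k u)) = ennreal (\<Sum>k<n. c (Suc k) * rad k u)"
      using c_pos rad_nonneg
      by (subst sum_ennreal[symmetric]) (auto simp: ennreal_mult less_imp_le)
    also have "(\<Sum>k<n. c (Suc k) * rad k u) \<le> 4 * (\<Sum>k\<le>n. c k * rad k u)"
      using c_pos[of n] rad_nonneg[of n u]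
      by (simp add: c_Suc sum_distrib_left mult.assoc lessThan_Suc_atMost[symmetric])
    also have "\<dots> \<le> 4 * (4 / 3 * S)" by (intro mult_left_mono sum_c_rad) auto
    finally show "(\<Sum>k<n. ennreal (c (Suc k)) * ennreal (rad k u)) \<le> ennreal (16 / 3 * S)"
      by (simp add: ennreal_leI)
  qed
  also have "\<dots> = ennreal (16 / 3 * S)" by (simp add: emeasure_space_1)
  finally show ?thesis .
qed

text \<open>At level 0 the required mass is 1 / \<phi>(c 0) = 1.\<close>

lemma AE_dist_le_rad_0: "AE w in m. dist u w \<le> rad 0 u"
proof -
  have "measure m (cball u (rad 0 u)) = 1"
    using measure_cball_rad[of 0 u] prob_le_1[of "cball u (rad 0 u)"] by (simp add: phi_c0)
  then have "AE w in m. w \<in> cball u (rad 0 u)" by (rule AE_prob_1)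
  then show ?thesis by simp
qed

lemma mean_dev_process_measurable [measurable]:
  "(\<lambda>(\<omega>, u). mean_dev (\<lambda>t. Y t \<omega>) u) \<in> borel_measurable (P \<Otimes>\<^sub>M m)"
  unfolding mean_dev_def split_beta by measurable

text \<open>Almost every \<open>w\<close> lies within \<open>rad 0 u\<close> of \<open>u\<close>, so
  the mean increment is at most 2 c(0) rad 0 u, a single term of the weighted sum of radii.\<close>

lemma mean_mean_dev_le:
  "(\<integral>\<^sup>+\<omega>. (\<integral>\<^sup>+u. mean_dev (\<lambda>t. Y t \<omega>) u \<partial>m) \<partial>P) \<le> ennreal (8 / 3 * S)"
proof -
  interpret pair_sigma_finite P m ..
  have "(\<integral>\<^sup>+\<omega>. (\<integral>\<^sup>+u. mean_dev (\<lambda>t. Y t \<omega>) u \<partial>m) \<partial>P)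
      = (\<integral>\<^sup>+u. (\<integral>\<^sup>+\<omega>. mean_dev (\<lambda>t. Y t \<omega>) u \<partial>P) \<partial>m)"
    by (rule Fubini'[symmetric]) measurable
  also have "\<dots> \<le> (\<integral>\<^sup>+u. ennreal (8 / 3 * S) \<partial>m)"
  proof (rule nn_integral_mono)
    fix u
    have "(\<integral>\<^sup>+\<omega>. mean_dev (\<lambda>t. Y t \<omega>) u \<partial>P) = (\<integral>\<^sup>+w. (\<integral>\<^sup>+\<omega>. ennreal \<bar>Y u \<omega> - Y w \<omega>\<bar> \<partial>P) \<partial>m)"
      unfolding mean_dev_def by (rule Fubini'[symmetric]) measurable
    also have "\<dots> \<le> (\<integral>\<^sup>+w. ennreal (2 * (c 0 * rad 0 u)) \<partial>m)"
      using AE_dist_le_rad_0[of u]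
    proof (intro nn_integral_mono_AE, eventually_elim)
      fix w assume "dist u w \<le> rad 0 u"
      then show "(\<integral>\<^sup>+\<omega>. ennreal \<bar>Y u \<omega> - Y w \<omega>\<bar> \<partial>P) \<le> ennreal (2 * (c 0 * rad 0 u))"
        using c_pos[of 0] by (intro order_trans[OF mean_process_increment_le] ennreal_leI) simp
    qed
    also have "\<dots> \<le> ennreal (8 / 3 * S)"
      using c_rad_le[of 0 u] by (simp add: emeasure_space_1 ennreal_leI)
    finally show "(\<integral>\<^sup>+\<omega>. mean_dev (\<lambda>t. Y t \<omega>) u \<partial>P) \<le> ennreal (8 / 3 * S)" .
  qed
  also have "\<dots> = ennreal (8 / 3 * S)" by (simp add: emeasure_space_1)
  finally show ?thesis .
qed

lemma local_dev_process_measurable [measurable]: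
  "(\<lambda>\<omega>. local_dev k (\<lambda>t. Y t \<omega>) u) \<in> borel_measurable P"
  unfolding local_dev_def
  by (rule nn_integral_law_measurable[where f = "\<lambda>_. u"]) (auto simp: space_UNIV split_beta)

text \<open>The mean error of replacing a point by its ball; it vanishes as the radii
  shrink.\<close>

lemma mean_local_dev_le:
  "(\<integral>\<^sup>+\<omega>. local_dev k (\<lambda>t. Y t \<omega>) u \<partial>P) \<le> ennreal (2 * c 0 * rad k u)"
proof -
  interpret L: prob_space "law k u" by (rule prob_space_law)
  interpret PL: pair_sigma_finite P "law k u" ..
  have "(\<integral>\<^sup>+\<omega>. local_dev k (\<lambda>t. Y t \<omega>) u \<partial>P) = (\<integral>\<^sup>+v. (\<integral>\<^sup>+\<omega>. ennreal \<bar>Y u \<omega> - Y v \<omega>\<bar> \<partial>P) \<partial>law k u)"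
    unfolding local_dev_def by (rule PL.Fubini'[symmetric]) measurable
  also have "\<dots> \<le> (\<integral>\<^sup>+v. ennreal (2 * c 0 * rad k u) \<partial>law k u)"
  proof (intro nn_integral_mono_AE AE_law)
    fix v assume "dist u v \<le> rad k u"
    then show "(\<integral>\<^sup>+\<omega>. ennreal \<bar>Y u \<omega> - Y v \<omega>\<bar> \<partial>P) \<le> ennreal (2 * c 0 * rad k u)"
      using c_pos[of 0] by (intro order_trans[OF mean_process_increment_le] ennreal_leI) simp
  qed
  finally show ?thesis by simp
qed

text \<open>For each \<open>n\<close>, a point of F is controlled by its local deviation at scale
  \<open>n\<close> and the terms of \<open>chaining\<close>. In expectation the latter give 2 (8/3 +
  16/3 + 8) S = 32 S, and letting \<open>n\<close> grow removes the local deviations.\<close>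

lemma expected_sup_le:
  assumes F: "finite F"
  shows "(\<integral>\<^sup>+\<omega>. (SUP (s, t) \<in> F \<times> F. ennreal \<bar>Y s \<omega> - Y t \<omega>\<bar>) \<partial>P) \<le> ennreal (32 * S)"
    (is "?E \<le> _")
proof -
  have bound: "?E \<le> ennreal (32 * S + 4 * c 0 * (\<Sum>s\<in>F. rad n s))" for n
  proof -
    define A where "A \<omega> = (\<integral>\<^sup>+u. mean_dev (\<lambda>t. Y t \<omega>) u \<partial>m)" for \<omega>
    define C where "C \<omega> = (\<Sum>k<n. ennreal (c (Suc k)) * level_energy k (\<lambda>t. Y t \<omega>))" for \<omega>
    \<comment> \<open>The sum dominates the local deviation at every point of F at once. F is finite
      and fixed while \<open>n\<close> grows, so its expectation still tends to 0.\<close>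
    define L where "L \<omega> = (\<Sum>s\<in>F. local_dev n (\<lambda>t. Y t \<omega>) s)" for \<omega>
    have [measurable]: "A \<in> borel_measurable P" unfolding A_def by measurable
    have [measurable]: "C \<in> borel_measurable P" unfolding C_def by measurable
    have [measurable]: "L \<in> borel_measurable P" unfolding L_def by measurable
    have "?E \<le> (\<integral>\<^sup>+\<omega>. 2 * (L \<omega> + (A \<omega> + C \<omega> + ennreal (8 * S))) \<partial>P)"
    proof (intro nn_integral_mono SUP_least, clarify)
      fix \<omega> s t assume \<omega>: "\<omega> \<in> space P" and st: "s \<in> F" "t \<in> F"
      note f = path_measurable[OF \<omega>]
      have *: "mean_dev (\<lambda>t. Y t \<omega>) s \<le> L \<omega> + (A \<omega> + C \<omega> + ennreal (8 * S))" if "s \<in> F" for s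
      proof -
        have "(\<integral>\<^sup>+v. mean_dev (\<lambda>t. Y t \<omega>) v \<partial>law n s) \<le> A \<omega> + C \<omega> + ennreal (det_bound n s)"
          unfolding A_def C_def by (rule chaining[OF f])
        also have "\<dots> \<le> A \<omega> + C \<omega> + ennreal (8 * S)"
          by (intro add_left_mono ennreal_leI det_bound_le)
        finally have "(\<integral>\<^sup>+v. mean_dev (\<lambda>t. Y t \<omega>) v \<partial>law n s) \<le> A \<omega> + C \<omega> + ennreal (8 * S)" .
        moreover have "local_dev n (\<lambda>t. Y t \<omega>) s \<le> L \<omega>"
          unfolding L_def by (rule member_le_sum) (use that F in auto)
        ultimately show ?thesis by (intro order_trans[OF mean_dev_le[OF f, of s n]] add_mono)
      qed
      show "ennreal \<bar>Y s \<omega> - Y t \<omega>\<bar> \<le> 2 * (L \<omega> + (A \<omega> + C \<omega> + ennreal (8 * S)))"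
        unfolding mult_2
        by (intro order_trans[OF increment_le_mean_dev[OF f, of s t]] add_mono * st)
    qed
    also have "\<dots> = 2 * ((\<integral>\<^sup>+\<omega>. L \<omega> \<partial>P) + ((\<integral>\<^sup>+\<omega>. A \<omega> \<partial>P) + (\<integral>\<^sup>+\<omega>. C \<omega> \<partial>P) + ennreal (8 * S)))"
      by (simp add: nn_integral_cmult nn_integral_add P.emeasure_space_1)
    also have "\<dots> \<le> 2 * ((\<Sum>s\<in>F. ennreal (2 * c 0 * rad n s))
        + (ennreal (8 / 3 * S) + ennreal (16 / 3 * S) + ennreal (8 * S)))"
    proof -
      have "(\<integral>\<^sup>+\<omega>. L \<omega> \<partial>P) \<le> (\<Sum>s\<in>F. ennreal (2 * c 0 * rad n s))"
        unfolding L_def by (subst nn_integral_sum) (auto intro!: sum_mono mean_local_dev_le)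
      moreover have "(\<integral>\<^sup>+\<omega>. A \<omega> \<partial>P) \<le> ennreal (8 / 3 * S)"
        unfolding A_def by (rule mean_mean_dev_le)
      moreover have "(\<integral>\<^sup>+\<omega>. C \<omega> \<partial>P) \<le> ennreal (16 / 3 * S)"
        unfolding C_def by (rule mean_sum_level_energy_le)
      ultimately show ?thesis by (intro mult_left_mono add_mono order_refl) auto
    qed
    also have "\<dots> = ennreal (2 * ((\<Sum>s\<in>F. 2 * c 0 * rad n s) + (8 / 3 * S + 16 / 3 * S + 8 * S)))"
    proof -
      have nn: "0 \<le> 2 * c 0 * rad n s" for s using c_pos[of 0] rad_nonneg[of n s] by simp
      have "2 * (ennreal a + (ennreal b + ennreal d + ennreal e)) = ennreal (2 * (a + (b + d + e)))"
        if "0 \<le> a" "0 \<le> b" "0 \<le> d" "0 \<le> e" for a b d e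
        using that
        by (simp only: ennreal_mult' ennreal_plus add_nonneg_nonneg ennreal_numeral zero_le_numeral)
      from this[of "\<Sum>s\<in>F. 2 * c 0 * rad n s" "8 / 3 * S" "16 / 3 * S" "8 * S"]
      show ?thesis using S_nonneg nn by (simp only: sum_ennreal[OF nn] sum_nonneg[OF nn])
    qed
    also have "2 * ((\<Sum>s\<in>F. 2 * c 0 * rad n s) + (8 / 3 * S + 16 / 3 * S + 8 * S))
        = 32 * S + 4 * c 0 * (\<Sum>s\<in>F. rad n s)"
      by (simp add: sum_distrib_left[symmetric])
    finally show ?thesis .
  qed
  have "(\<lambda>n. 32 * S + 4 * c 0 * (\<Sum>s\<in>F. rad n s)) \<longlonglongrightarrow> 32 * S + 4 * c 0 * (\<Sum>s\<in>F. 0)"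
    by (intro tendsto_intros rad_tendsto_0)
  then have "(\<lambda>n. ennreal (32 * S + 4 * c 0 * (\<Sum>s\<in>F. rad n s))) \<longlonglongrightarrow> ennreal (32 * S)"
    by (intro tendsto_ennrealI) simp
  then show ?thesis by (rule LIMSEQ_le_const) (use bound in auto)
qed

end

end

section \<open>Passage from the jointly measurable modification back to the given process\<close>

theorem theorem1p1:
  fixes m :: "'a::metric_space measure"
    and \<phi> :: "real \<Rightarrow> real"
    and P :: "'w measure"
    and X :: "'a \<Rightarrow> 'w \<Rightarrow> real"
  assumes "prob_space m"
    and "sets m = sets borel"
    and "msupport m = UNIV"
    and "young_function \<phi>"
    and "majorizing_sup \<phi> m < \<infinity>"
    and "prob_space P"
    and "separable_process P X"
    and "(SUP (s, t) \<in> UNIV. \<integral>\<^sup>+\<omega>. ennreal (\<phi> (\<bar>X s \<omega> - X t \<omega>\<bar> / dist s t)) \<partial>P) \<le> 1"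
  shows "expected_sup_incr P X \<le> 32 * majorizing_sup \<phi> m"
proof -
  interpret majorizing_measure m \<phi>
    using assms by (intro majorizing_measure.intro majorizing_measure_axioms.intro)
  have X [measurable]: "X t \<in> borel_measurable P" for t
    using assms(7) by (simp add: separable_process_def)
  have X_le_1: "(\<integral>\<^sup>+\<omega>. energy (\<lambda>t. X t \<omega>) s t \<partial>P) \<le> 1" for s t
    using order_trans[OF SUP_upper[of "(s, t)" UNIV] assms(8)] by (simp add: energy_def)
  have X_inc: "(\<integral>\<^sup>+\<omega>. ennreal \<bar>X s \<omega> - X t \<omega>\<bar> \<partial>P) \<le> ennreal (2 * c 0 * dist s t)" for s t
    by (rule mean_increment_le[OF assms(6) X X X_le_1])
  obtain Y where Y: "(\<lambda>(\<omega>, u). Y u \<omega>) \<in> borel_measurable (P \<Otimes>\<^sub>M m)"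
    and eq: "\<And>u. AE \<omega> in P. Y u \<omega> = X u \<omega>"
    by (rule measurable_modification[OF X X_inc]) (use c_pos[of 0] in auto)
  have Y_le_1: "(\<integral>\<^sup>+\<omega>. energy (\<lambda>t. Y t \<omega>) u v \<partial>P) \<le> 1" for u v
  proof -
    have "AE \<omega> in P. energy (\<lambda>t. Y t \<omega>) u v = energy (\<lambda>t. X t \<omega>) u v"
      using eq[of u] eq[of v] by eventually_elim (simp add: energy_def)
    from nn_integral_cong_AE[OF this] show ?thesis using X_le_1[of u v] by simp
  qed
  have "(\<integral>\<^sup>+\<omega>. (SUP (s, t) \<in> F \<times> F. ennreal \<bar>X s \<omega> - X t \<omega>\<bar>) \<partial>P) \<le> ennreal (32 * S)"
    if "finite F" for F
  proof -
    \<comment> \<open>The exceptional null set depends on \<open>u\<close>; finitely many of them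
      still form a null set.\<close>
    have "AE \<omega> in P. \<forall>u\<in>F. Y u \<omega> = X u \<omega>" using that eq by (simp add: AE_finite_all)
    then have "AE \<omega> in P. (SUP (s, t) \<in> F \<times> F. ennreal \<bar>X s \<omega> - X t \<omega>\<bar>)
        = (SUP (s, t) \<in> F \<times> F. ennreal \<bar>Y s \<omega> - Y t \<omega>\<bar>)"
      by eventually_elim (intro SUP_cong, auto)
    from nn_integral_cong_AE[OF this] show ?thesis
      using expected_sup_le[OF assms(6) Y Y_le_1 that] by simp
  qed
  then have "expected_sup_incr P X \<le> ennreal (32 * S)"
    unfolding expected_sup_incr_def by (intro SUP_least) simp
  also have "\<dots> = 32 * majorizing_sup \<phi> m"
    using S_nonneg by (simp add: majorizing_sup_eq ennreal_mult')
  finally show ?thesis .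
qed

end
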